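(* Let $(\ell,\mathcal P,\mathcal F)$ be a decision problem, and suppose that the losses $\ell_f$ take values in $[0,a]$. 1. Suppose the $u$-Bernstein condition holds for a function $u:[0,\infty)\to[0,\infty)$ that is non-decreasing, with $u(x)>0$ for all $x>0$ and $u(x)/x$ non-increasing (so that, in particular, for every $P\in\mathcal P$ the minimal risk over $\mathcal F$ is achieved by some $f^*\in\mathcal F$). Let $b>0$ be any finite constant, $c_1^b=1/\kappa(2ba)$, and $$v(x)=\min\left\{\frac{c_1^b\,x}{u(x)},\,b\right\},$$ where if $u(0)=0$ we read $0/u(0)$ as $\liminf_{x\downarrow0}x/u(x)$. Then (a) the $v$-central condition holds; and (b) additionally, for each $P\in\mathcal P$, any $\mathcal F$-optimal $f^*$ for $P$, and any $\delta>0$, we have $\mathbf E_{Z\sim P}[e^{\eta(\ell_{f^*}(Z)-\ell_f(Z))}]\le1$ for all $f\in\mathcal F$ with $R(P,f)-R(P,f^* )\ge\delta$, where $\eta=v(\delta)$. 2. On the other hand, suppose that for every $P\in\mathcal P$ there is $f^*\in\mathcal F$ with $R(P,f^* )=\inf_{f\in\mathcal F}R(P,f)$. If the $v$-pseudoprobability convexity condition holds for a bounded, non-decreasing function $v:[0,\infty)\to[0,\infty)$ with $v(x)>0$ for all $x>0$ and such that $x/v(x)$ is nondecreasing, then the $u$-Bernstein condition holds for $$u(x)=\frac{c_2\,x}{v(x)},$$ where $c_2=6/\kappa(-2ba)$ with $b=\sup_xv(x)<\infty$, and if $v(0)=0$ we read $0/v(0)$ as $\lim_{x\downarrow0}x/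v(x)$.
   Context: A decision problem $(\ell,\mathcal P,\mathcal F)$ consists of a set $\mathcal P$ of probability distributions on a sample space $\mathcal Z$, a set $\mathcal F$ and a loss $\ell$, with $\ell_f(z)=\ell(f,z)$ and $R(P,f)=\mathbf E_{Z\sim P}[\ell_f(Z)]$. $\Delta(\mathcal F)$ is the set of probability distributions on $\mathcal F$ (with an appropriate $\sigma$-algebra). $f^*\in\mathcal F$ is $\mathcal F$-optimal for $P$ if $R(P,f^* )=\inf_{f\in\mathcal F}R(P,f)$. $\kappa(x)=(e^x-x-1)/x^2$ for $x\ne0$, $\kappa(0)=1/2$. $u$-Bernstein condition (for $u:[0,\infty)\to[0,\infty)$ non-decreasing, $u(x)>0$ for $x>0$, $u(x)/x$ non-increasing): for all $P\in\mathcal P$ there exists an $\mathcal F$-optimal $f^*\in\mathcal F$ such that $\mathbf{Var}_{Z\sim P}(\ell_f(Z)-\ell_{f^*}(Z))\le u(\mathbf E_{Z\sim P}[\ell_f(Z)-\ell_{f^*}(Z)])$ for all $f\in\mathcal F$. Mix loss: $m^\eta_\Pi(z)=-\frac1\eta\log\mathbf E_{f\sim\Pi}[e^{-\eta\ell_f(z)}]$. For $v:[0,\infty)\to[0,\infty)$ bounded, non-decreasing with $v(x)>0$ for $x>0$: the $v$-central condition holds if for all $\epsilon\ge0$ there is $\phi:\mathcal P\to\mathcal F$ such that, with $\eta=v(\epsilon)$, $\mathbf E_{Z\sim P}\mathbf E_{f\sim\Pi}[e^{\eta(\ell_{\phi(P)}(Z)-\ell_f(Z))}]\le e^{\eta\epsilon}$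 for all $P\in\mathcal P$, $\Pi\in\Delta(\mathcal F)$. The $v$-pseudoprobability convexity (PPC) condition holds if for all $\epsilon\ge0$ there is $\phi:\mathcal P\to\mathcal F$ such that, with $\eta=v(\epsilon)$, $\mathbf E_{Z\sim P}[\ell_{\phi(P)}(Z)]\le\mathbf E_{Z\sim P}[m^\eta_\Pi(Z)]+\epsilon$ for all $P\in\mathcal P$, $\Pi\in\Delta(\mathcal F)$. If $v(0)=0$, the requirement at $\epsilon=0$ is vacuous.
   Formalization: In 1(b), when u(0)>0, f* is required to be an F-optimal action for which the Bernstein inequality itself holds for P (for u(0)=0 any F-optimal f* is allowed); for other optimal f* the claim as stated is false. *)

theory Defs
  imports "HOL-Probability.Probability"
begin

text \<open>
  A decision problem consists of a loss \<open>\<l>\<close>, a measurable sample space \<open>Z\<close>, a set \<open>\<P>\<close> of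
  probability measures on \<open>Z\<close>, and a measurable space \<open>F\<close>: its carrier \<open>space F\<close> is the set of
  actions and its sigma-algebra is the one underlying \<open>\<Delta>(F)\<close>.  Only the measurable-space
  structure of \<open>Z\<close> and \<open>F\<close> is used, never the measure they carry.  The sigma-algebra on
  \<open>F\<close> is arbitrary subject to the loss being jointly measurable, so that the iterated
  expectations over \<open>F\<close> and \<open>Z\<close> are meaningful.
\<close>

definition decision_problem ::
    "('f \<Rightarrow> 'z \<Rightarrow> real) \<Rightarrow> 'z measure \<Rightarrow> 'z measure set \<Rightarrow> 'f measure \<Rightarrow> bool" where
  "decision_problem \<l> Z \<P> F \<longleftrightarrow>
     \<P> \<subseteq> space (prob_algebra Z) \<and>
     (\<lambda>(f, z). \<l> f z) \<in> borel_measurable (F \<Otimes>\<^sub>M Z)"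

definition risk :: "('f \<Rightarrow> 'z \<Rightarrow> real) \<Rightarrow> 'z measure \<Rightarrow> 'f \<Rightarrow> real" where
  "risk \<l> P f = (LINT z|P. \<l> f z)"

definition optimal :: "('f \<Rightarrow> 'z \<Rightarrow> real) \<Rightarrow> 'f measure \<Rightarrow> 'z measure \<Rightarrow> 'f \<Rightarrow> bool" where
  "optimal \<l> F P fs \<longleftrightarrow> fs \<in> space F \<and> risk \<l> P fs = (INF f\<in>space F. risk \<l> P f)"

definition kappa :: "real \<Rightarrow> real" where
  "kappa x = (if x = 0 then 1 / 2 else (exp x - x - 1) / x\<^sup>2)"

text \<open>
  Functions \<open>[0,\<infinity>) \<Rightarrow> [0,\<infinity>)\<close> are represented by total functions on the reals, of which only the
  values on \<open>{0..}\<close> matter.  Monotonicity of \<open>u(x)/x\<close> is imposed on \<open>{0<..}\<close>, as the totalised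
  quotient \<open>u 0 / 0 = 0\<close> has no mathematical meaning.
\<close>

definition bernstein_function :: "(real \<Rightarrow> real) \<Rightarrow> bool" where
  "bernstein_function u \<longleftrightarrow>
     u \<in> {0..} \<rightarrow> {0..} \<and> mono_on {0..} u \<and> (\<forall>x>0. u x > 0) \<and>
     antimono_on {0<..} (\<lambda>x. u x / x)"

definition rate_function :: "(real \<Rightarrow> real) \<Rightarrow> bool" where
  "rate_function v \<longleftrightarrow>
     v \<in> {0..} \<rightarrow> {0..} \<and> bdd_above (v ` {0..}) \<and> mono_on {0..} v \<and> (\<forall>x>0. v x > 0)"

text \<open>
  The Bernstein condition only asks for some optimal action satisfying the variance inequality.
  If \<open>u 0 = 0\<close>, all optimal actions of \<open>P\<close> have almost surely equal losses, so each of them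
  satisfies it; if \<open>u 0 > 0\<close>, other optimal actions may violate it.  The predicate
  \<open>bernstein_at\<close> therefore singles out the optimal actions that witness the condition.
\<close>

definition bernstein_at ::
    "(real \<Rightarrow> real) \<Rightarrow> ('f \<Rightarrow> 'z \<Rightarrow> real) \<Rightarrow> 'f measure \<Rightarrow> 'z measure \<Rightarrow> 'f \<Rightarrow> bool" where
  "bernstein_at u \<l> F P fs \<longleftrightarrow> optimal \<l> F P fs \<and>
     (\<forall>f\<in>space F. prob_space.variance P (\<lambda>z. \<l> f z - \<l> fs z)
                      \<le> u (prob_space.expectation P (\<lambda>z. \<l> f z - \<l> fs z)))"

definition bernstein_condition ::
    "(real \<Rightarrow> real) \<Rightarrow> ('f \<Rightarrow> 'z \<Rightarrow> real) \<Rightarrow> 'z measure set \<Rightarrow> 'f measure \<Rightarrow> bool" where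
  "bernstein_condition u \<l> \<P> F \<longleftrightarrow>
     bernstein_function u \<and> (\<forall>P\<in>\<P>. \<exists>fs. bernstein_at u \<l> F P fs)"

definition mix_loss ::
    "real \<Rightarrow> ('f \<Rightarrow> 'z \<Rightarrow> real) \<Rightarrow> 'f measure \<Rightarrow> 'z \<Rightarrow> real" where
  "mix_loss \<eta> \<l> Q z = - (1 / \<eta>) * ln (LINT f|Q. exp (- \<eta> * \<l> f z))"

text \<open>
  For a rate function \<open>v\<close> and \<open>\<epsilon> \<ge> 0\<close>, \<open>v \<epsilon> = 0\<close> is possible only if \<open>\<epsilon> = 0\<close>; the guard
  \<open>v \<epsilon> > 0\<close> below thus expresses precisely that the requirement at \<open>\<epsilon> = 0\<close> is vacuous
  if \<open>v 0 = 0\<close>.  The set \<open>\<Delta>(F)\<close> is \<open>space (prob_algebra F)\<close>.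
\<close>

definition central_condition ::
    "(real \<Rightarrow> real) \<Rightarrow> ('f \<Rightarrow> 'z \<Rightarrow> real) \<Rightarrow> 'z measure set \<Rightarrow> 'f measure \<Rightarrow> bool" where
  "central_condition v \<l> \<P> F \<longleftrightarrow> rate_function v \<and>
     (\<forall>\<epsilon>\<ge>0. v \<epsilon> > 0 \<longrightarrow>
       (\<exists>\<phi>\<in>\<P> \<rightarrow> space F. \<forall>P\<in>\<P>. \<forall>Q\<in>space (prob_algebra F).
          (LINT z|P. LINT f|Q. exp (v \<epsilon> * (\<l> (\<phi> P) z - \<l> f z))) \<le> exp (v \<epsilon> * \<epsilon>)))"

definition ppc_condition ::
    "(real \<Rightarrow> real) \<Rightarrow> ('f \<Rightarrow> 'z \<Rightarrow> real) \<Rightarrow> 'z measure set \<Rightarrow> 'f measure \<Rightarrow> bool" where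
  "ppc_condition v \<l> \<P> F \<longleftrightarrow> rate_function v \<and>
     (\<forall>\<epsilon>\<ge>0. v \<epsilon> > 0 \<longrightarrow>
       (\<exists>\<phi>\<in>\<P> \<rightarrow> space F. \<forall>P\<in>\<P>. \<forall>Q\<in>space (prob_algebra F).
          (LINT z|P. \<l> (\<phi> P) z) \<le> (LINT z|P. mix_loss (v \<epsilon>) \<l> Q z) + \<epsilon>))"

text \<open>
  The quotient \<open>x / g x\<close>, with \<open>0/0\<close> at \<open>x = 0\<close> read as the limit inferior, respectively the
  limit, of the quotient as \<open>x\<close> decreases to 0.  The limit inferior is taken in the extended
  reals because \<open>Liminf\<close> requires a complete lattice; for a Bernstein function \<open>g\<close> it is finite.
\<close>

definition quot_liminf :: "(real \<Rightarrow> real) \<Rightarrow> real \<Rightarrow> real" where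
  "quot_liminf g x =
     (if x = 0 \<and> g 0 = 0 then real_of_ereal (Liminf (at_right 0) (\<lambda>t. ereal (t / g t)))
      else x / g x)"

definition quot_lim :: "(real \<Rightarrow> real) \<Rightarrow> real \<Rightarrow> real" where
  "quot_lim g x =
     (if x = 0 \<and> g 0 = 0 then Lim (at_right 0) (\<lambda>t. t / g t) else x / g x)"

end

theory Submission
  imports Defs
begin

text \<open>
  Let \<open>X\<close> be the excess loss of an action over an optimal one and \<open>r \<ge> 0\<close> its mean.

  For the first part, \<open>exp y = 1 + y + kappa y * y\<^sup>2\<close> and monotonicity of \<open>kappa\<close> bound the mean of
  \<open>exp (- \<eta> * X)\<close> by \<open>exp (- \<eta> * r + kappa (2 * b * a) * \<eta>\<^sup>2 * Var X)\<close>. The Bernstein condition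
  bounds \<open>Var X\<close> by \<open>u r\<close>, and \<open>kappa (2 * b * a) * \<eta> * u r \<le> max r \<epsilon>\<close> for \<open>\<eta> = v \<epsilon>\<close>; averaging
  over the actions gives the central condition.

  For the second part, apply PPC to the uniform distribution on the two actions. It bounds the mean
  of \<open>ln ((1 + exp (- \<eta> * X)) / 2) = - \<eta> * X / 2 + ln (cosh (\<eta> * X / 2))\<close> by \<open>\<eta> * \<epsilon>\<close>, while
  \<open>ln (cosh (y / 2)) \<ge> kappa (- 2 * b * a) / 4 * y\<^sup>2\<close> for \<open>\<bar>y\<bar> \<le> b * a\<close>. Hence the second moment of
  \<open>X\<close> is at most \<open>4 / kappa (- 2 * b * a) * (\<epsilon> + r / 2) / \<eta>\<close>, and \<open>\<epsilon> = r\<close> gives the constant 6.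
  If \<open>r = 0\<close> and \<open>v 0 = 0\<close>, let \<open>\<epsilon>\<close> tend to 0 instead.
\<close>

section \<open>The function \<open>kappa\<close> and elementary inequalities for \<open>exp\<close>
  and \<open>ln\<close>\<close>

text \<open>This is the integral remainder in Taylor's formula for \<open>exp\<close>, divided by
  the square of \<open>x\<close>. For each \<open>s\<close> in the unit interval the integrand is
  nondecreasing in \<open>x\<close>, which yields monotonicity of \<open>kappa\<close>.\<close>

lemma kappa_has_integral: "((\<lambda>s. (1 - s) * exp (s * x)) has_integral kappa x) {0..1}"
proof (cases "x = 0")
  case True
  have "((\<lambda>s. (1 - s) * exp (s * 0)) has_integral (1 - 1\<^sup>2 / 2) - (0 - 0\<^sup>2 / 2)) {0..(1::real)}"
    by (rule fundamental_theorem_of_calculus)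
      (auto intro!: derivative_eq_intros simp flip: has_real_derivative_iff_has_vector_derivative)
  with True show ?thesis
    by (simp add: kappa_def)
next
  case False
  let ?G = "\<lambda>s. (1 - s) * exp (s * x) / x + exp (s * x) / x\<^sup>2"
  have "((\<lambda>s. (1 - s) * exp (s * x)) has_integral ?G 1 - ?G 0) {0..1}"
  proof (rule fundamental_theorem_of_calculus)
    fix s :: real
    have "(?G has_real_derivative (1 - s) * exp (s * x)) (at s within {0..1})"
      using False by (auto intro!: derivative_eq_intros simp: field_simps power2_eq_square)
    then show "(?G has_vector_derivative (1 - s) * exp (s * x)) (at s within {0..1})"
      by (simp add: has_real_derivative_iff_has_vector_derivative)
  qed simp
  moreover have "?G 1 - ?G 0 = kappa x"
    using False by (simp add: kappa_def field_simps power2_eq_square)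
  ultimately show ?thesis
    by simp
qed

lemma kappa_mono: "x \<le> y \<Longrightarrow> kappa x \<le> kappa y"
  by (rule has_integral_le[OF kappa_has_integral kappa_has_integral])
    (auto intro!: mult_left_mono)

lemma exp_eq_kappa: "exp x = 1 + x + kappa x * x\<^sup>2"
  by (simp add: kappa_def)

lemma kappa_pos: "kappa x > 0"
proof (cases "x = 0")
  case False
  \<comment> \<open>Equality would mean \<open>ln y = y - 1\<close> at \<open>y = exp x\<close>,
    which happens only for \<open>y = 1\<close>.\<close>
  then have "exp x > 1 + x"
    using ln_eq_minus_one[of "exp x"] exp_ge_add_one_self[of x]
    by (metis add_diff_cancel_left' exp_eq_one_iff exp_gt_zero ln_exp order_le_imp_less_or_eq)
  with False show ?thesis
    by (simp add: kappa_def)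
qed (simp add: kappa_def)

text \<open>
  Both sides vanish at 0. With \<open>q = exp (- t)\<close>, the inequality between their derivatives amounts
  to \<open>(1 + q)\<^sup>2 \<le> 4\<close>.
\<close>

lemma log_mean_exp_minus_ge_aux:
  fixes t :: real
  assumes "t \<ge> 0"
  shows "(exp (- 2 * t) + 2 * t - 1) / 16 \<le> ln ((1 + exp (- t)) / 2) + t / 2"
proof -
  let ?g = "\<lambda>t::real. ln ((1 + exp (- t)) / 2) + t / 2 - (exp (- 2 * t) + 2 * t - 1) / 16"
  have "?g 0 \<le> ?g t"
  proof (rule DERIV_nonneg_imp_nondecreasing[OF assms])
    fix x :: real
    assume x: "0 \<le> x"
    define q where "q = exp (- x)"
    have q: "0 < q" "q \<le> 1"
      using x by (auto simp: q_def)
    have sq: "exp (- 2 * x) = q * q"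
      by (simp add: q_def flip: exp_add)
    have pos: "(1 + exp (- x)) / 2 > 0"
      by (simp add: add_pos_pos)
    have "(?g has_real_derivative - q / (1 + q) + 1 / 2 - (1 - q * q) / 8) (at x)"
      unfolding sq[symmetric] unfolding q_def
      using pos by (auto intro!: derivative_eq_intros simp: divide_simps) (simp_all add: algebra_simps)
    moreover have "- q / (1 + q) + 1 / 2 - (1 - q * q) / 8 = (1 - q) * (4 - (1 + q)\<^sup>2) / (8 * (1 + q))"
      using q by (simp add: divide_simps) (simp add: algebra_simps power2_eq_square)
    moreover have "(1 + q)\<^sup>2 \<le> 2\<^sup>2"
      using q by (intro power_mono) auto
    ultimately show "\<exists>d. (?g has_real_derivative d) (at x) \<and> 0 \<le> d"
      using q by (intro exI[of _ "(1 - q) * (4 - (1 + q)\<^sup>2) / (8 * (1 + q))"]) auto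
  qed
  then show ?thesis
    by simp
qed

text \<open>The right-hand side is \<open>ln (cosh (y / 2))\<close>, hence even in \<open>y\<close>.
  Monotonicity of \<open>kappa\<close> replaces \<open>A\<close> by \<open>\<bar>y\<bar>\<close>,
  and \<open>exp_eq_kappa\<close> at \<open>- 2 * \<bar>y\<bar>\<close> then turns the quadratic
  into the left-hand side of the auxiliary inequality.\<close>

lemma log_mean_exp_minus_ge:
  fixes y A :: real
  assumes "\<bar>y\<bar> \<le> A"
  shows "kappa (- 2 * A) / 4 * y\<^sup>2 \<le> ln ((1 + exp (- y)) / 2) + y / 2"
proof -
  have pos: "1 + exp x > 0" for x :: real
    by (simp add: add_pos_pos)
  have even: "ln ((1 + exp (- y)) / 2) + y / 2 = ln ((1 + exp (- \<bar>y\<bar>)) / 2) + \<bar>y\<bar> / 2"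
  proof (cases "y \<ge> 0")
    case False
    have "1 + exp (- y) = exp (- y) * (1 + exp y)"
      by (simp add: distrib_left flip: exp_add)
    then have "ln (1 + exp (- y)) = - y + ln (1 + exp y)"
      by (simp add: ln_mult_pos pos)
    with False show ?thesis
      using pos[of y] pos[of "- y"] by (simp add: ln_div)
  qed auto
  have "kappa (- 2 * A) \<le> kappa (- 2 * \<bar>y\<bar>)"
    using assms by (intro kappa_mono) auto
  then have "kappa (- 2 * A) / 4 * y\<^sup>2 \<le> kappa (- 2 * \<bar>y\<bar>) / 4 * y\<^sup>2"
    by (intro mult_right_mono) auto
  also have "\<dots> = kappa (- 2 * \<bar>y\<bar>) * (- 2 * \<bar>y\<bar>)\<^sup>2 / 16"
    by (simp add: power_mult_distrib)
  also have "\<dots> = (exp (- 2 * \<bar>y\<bar>) + 2 * \<bar>y\<bar> - 1) / 16"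
    using exp_eq_kappa[of "- 2 * \<bar>y\<bar>"] by simp
  also have "\<dots> \<le> ln ((1 + exp (- \<bar>y\<bar>)) / 2) + \<bar>y\<bar> / 2"
    by (rule log_mean_exp_minus_ge_aux) simp
  finally show ?thesis
    unfolding even .
qed

text \<open>An average of 1 and \<open>exp (- y)\<close> stays between \<open>exp (- B)\<close> and
  \<open>exp B\<close>. The bound makes the logarithms integrable.\<close>

lemma abs_log_mean_exp_minus_le:
  fixes y B :: real
  assumes "\<bar>y\<bar> \<le> B"
  shows "\<bar>ln ((1 + exp (- y)) / 2)\<bar> \<le> B"
proof -
  have mean: "p \<le> (1 + q) / 2 \<and> (1 + q) / 2 \<le> s"
    if "p \<le> q" "q \<le> s" "p \<le> 1" "1 \<le> s" for p q s :: real
    using that by auto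
  have "exp (- B) \<le> (1 + exp (- y)) / 2 \<and> (1 + exp (- y)) / 2 \<le> exp B"
    using assms by (intro mean) auto
  moreover from this have "0 < (1 + exp (- y)) / 2"
    by (meson exp_gt_zero less_le_trans)
  ultimately have "- B \<le> ln ((1 + exp (- y)) / 2) \<and> ln ((1 + exp (- y)) / 2) \<le> B"
    using ln_le_cancel_iff[of "(1 + exp (- y)) / 2" "exp B"] by (simp only: ln_ge_iff ln_exp exp_gt_zero)
  then show ?thesis
    by linarith
qed

section \<open>Moment estimates for bounded random variables\<close>

lemma (in prob_space) integrable_bounded:
  fixes X :: "'a \<Rightarrow> real"
  assumes "X \<in> borel_measurable M" and "\<And>z. z \<in> space M \<Longrightarrow> \<bar>X z\<bar> \<le> B"
  shows "integrable M X"
  using assms by (intro integrable_const_bound[of _ B]) auto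

text \<open>Centring \<open>X\<close> at its mean \<open>r\<close> makes the linear term of
  \<open>exp_eq_kappa\<close> integrate to 0. The centred variable is at most \<open>2 * a\<close>
  in absolute value, whence the argument \<open>2 * b * a\<close> of \<open>kappa\<close>.\<close>

lemma (in prob_space) mgf_le_exp_variance:
  fixes X :: "'a \<Rightarrow> real"
  assumes X[measurable]: "X \<in> borel_measurable M"
    and bound: "\<And>z. z \<in> space M \<Longrightarrow> \<bar>X z\<bar> \<le> a"
    and \<eta>: "0 \<le> \<eta>" "\<eta> \<le> b"
  shows "(LINT z|M. exp (- \<eta> * X z))
    \<le> exp (- \<eta> * expectation X + kappa (2 * b * a) * \<eta>\<^sup>2 * variance X)"
proof -
  define r where "r = expectation X"
  let ?k = "kappa (2 * b * a)"
  have intX: "integrable M X"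
    using X bound by (rule integrable_bounded)
  have r: "- a \<le> r" "r \<le> a"
    unfolding r_def using bound
    by (force intro!: integral_ge_const[OF intX] integral_le_const[OF intX] AE_I2 simp: abs_le_iff)+
  have dev: "\<bar>X z - r\<bar> \<le> 2 * a" if "z \<in> space M" for z
    using bound[OF that] r by linarith
  have "\<bar>(X z - r)\<^sup>2\<bar> \<le> (2 * a)\<^sup>2" if "z \<in> space M" for z
    using power_mono[OF dev[OF that], of 2] by simp
  then have int2: "integrable M (\<lambda>z. (X z - r)\<^sup>2)"
    by (intro integrable_bounded) auto
  have pointwise: "exp (- \<eta> * (X z - r)) \<le> 1 - \<eta> * (X z - r) + ?k * \<eta>\<^sup>2 * (X z - r)\<^sup>2"
    if z: "z \<in> space M" for z
  proof -
    have "- \<eta> * (X z - r) \<le> \<eta> * \<bar>X z - r\<bar>"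
      using \<eta> by (metis abs_ge_minus_self abs_mult abs_of_nonneg minus_mult_left)
    also have "\<dots> \<le> b * (2 * a)"
      using \<eta> dev[OF z] by (intro mult_mono) auto
    finally have "kappa (- \<eta> * (X z - r)) \<le> ?k"
      by (intro kappa_mono) (simp add: algebra_simps)
    then have "kappa (- \<eta> * (X z - r)) * (- \<eta> * (X z - r))\<^sup>2 \<le> ?k * (- \<eta> * (X z - r))\<^sup>2"
      by (intro mult_right_mono) auto
    then show ?thesis
      unfolding exp_eq_kappa[of "- \<eta> * (X z - r)"] by (simp add: power_mult_distrib)
  qed
  \<comment> \<open>A bound free of \<open>z\<close>, used for integrability of the
    exponential.\<close>
  have "exp (- \<eta> * (X z - r)) \<le> 1 + \<eta> * (2 * a) + ?k * \<eta>\<^sup>2 * (2 * a)\<^sup>2" if "z \<in> space M" for z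
  proof -
    have "- \<eta> * (X z - r) \<le> \<eta> * (2 * a)"
      using \<eta> mult_left_mono[OF dev[OF that] \<eta>(1)]
      by (smt (verit) mult_minus_left mult_minus_right mult_left_mono)
    moreover have "?k * \<eta>\<^sup>2 * (X z - r)\<^sup>2 \<le> ?k * \<eta>\<^sup>2 * (2 * a)\<^sup>2"
      using power_mono[OF dev[OF that], of 2] kappa_pos[of "2 * b * a"]
      by (intro mult_left_mono) auto
    ultimately show ?thesis
      using pointwise[OF that] by simp
  qed
  then have intE: "integrable M (\<lambda>z. exp (- \<eta> * (X z - r)))"
    by (intro integrable_bounded) auto
  have "(LINT z|M. exp (- \<eta> * X z)) = exp (- \<eta> * r) * (LINT z|M. exp (- \<eta> * (X z - r)))"
    unfolding integral_mult_right_zero[symmetric] exp_add[symmetric] by (simp add: algebra_simps)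
  also have "(LINT z|M. exp (- \<eta> * (X z - r)))
      \<le> (LINT z|M. 1 - \<eta> * (X z - r) + ?k * \<eta>\<^sup>2 * (X z - r)\<^sup>2)"
    using intE intX int2 pointwise by (intro integral_mono) auto
  also have "\<dots> = 1 + ?k * \<eta>\<^sup>2 * variance X"
    using intX int2 by (simp add: r_def prob_space)
  also have "\<dots> \<le> exp (?k * \<eta>\<^sup>2 * variance X)"
    by simp
  finally show ?thesis
    by (simp add: r_def flip: exp_add)
qed

text \<open>\<open>log_mean_exp_minus_ge\<close> is integrated with \<open>y = \<eta> * X z\<close>
  and \<open>A = b * a\<close>. The second moment enters with the square of \<open>\<eta>\<close>;
  one factor cancels, the other becomes the denominator.\<close>

lemma (in prob_space) second_moment_le_of_log_mean_exp:
  fixes X :: "'a \<Rightarrow> real"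
  assumes X[measurable]: "X \<in> borel_measurable M"
    and bound: "\<And>z. z \<in> space M \<Longrightarrow> \<bar>X z\<bar> \<le> a"
    and \<eta>: "0 < \<eta>" "\<eta> \<le> b"
    and s: "(LINT z|M. ln ((1 + exp (- \<eta> * X z)) / 2)) \<le> \<eta> * s"
  shows "expectation (\<lambda>z. (X z)\<^sup>2) \<le> 4 / kappa (- 2 * b * a) * ((s + expectation X / 2) / \<eta>)"
proof -
  let ?k = "kappa (- 2 * b * a)"
  have k: "?k > 0"
    by (rule kappa_pos)
  have intX: "integrable M X"
    using X bound by (rule integrable_bounded)
  have "\<bar>(X z)\<^sup>2\<bar> \<le> a\<^sup>2" if "z \<in> space M" for z
    using power_mono[OF bound[OF that], of 2] by simp
  then have int2: "integrable M (\<lambda>z. (X z)\<^sup>2)"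
    by (intro integrable_bounded) auto
  have abs: "\<bar>\<eta> * X z\<bar> \<le> \<eta> * a" if "z \<in> space M" for z
    using bound[OF that] \<eta> by (simp add: abs_mult)
  have "\<bar>ln ((1 + exp (- (\<eta> * X z))) / 2)\<bar> \<le> \<eta> * a" if "z \<in> space M" for z
    using abs[OF that] by (rule abs_log_mean_exp_minus_le)
  then have intL: "integrable M (\<lambda>z. ln ((1 + exp (- (\<eta> * X z))) / 2))"
    by (intro integrable_bounded) auto
  have "?k / 4 * \<eta>\<^sup>2 * expectation (\<lambda>z. (X z)\<^sup>2) = (LINT z|M. ?k / 4 * (\<eta> * X z)\<^sup>2)"
    by (simp add: power_mult_distrib mult.assoc)
  also have "\<dots> \<le> (LINT z|M. ln ((1 + exp (- (\<eta> * X z))) / 2) + \<eta> * X z / 2)"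
  proof (rule integral_mono)
    fix z assume "z \<in> space M"
    from abs[OF this] have "\<bar>\<eta> * X z\<bar> \<le> b * a"
      by (smt (verit) \<eta> bound[OF \<open>z \<in> space M\<close>] mult_right_mono)
    from log_mean_exp_minus_ge[OF this]
    show "?k / 4 * (\<eta> * X z)\<^sup>2 \<le> ln ((1 + exp (- (\<eta> * X z))) / 2) + \<eta> * X z / 2"
      by (simp add: mult.assoc)
  qed (use intL intX int2 in \<open>auto simp: power_mult_distrib\<close>)
  also have "\<dots> = (LINT z|M. ln ((1 + exp (- (\<eta> * X z))) / 2)) + \<eta> * expectation X / 2"
    using intL intX by simp
  also have "\<dots> \<le> \<eta> * (s + expectation X / 2)"
    using s by (simp add: algebra_simps)
  finally have "\<eta> * (?k / 4 * \<eta> * expectation (\<lambda>z. (X z)\<^sup>2)) \<le> \<eta> * (s + expectation X / 2)"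
    by (simp only: power2_eq_square mult.assoc mult.left_commute)
  then have "?k / 4 * \<eta> * expectation (\<lambda>z. (X z)\<^sup>2) \<le> s + expectation X / 2"
    using \<eta> by simp
  then show ?thesis
    using k \<eta> by (simp add: field_simps)
qed

section \<open>The quotient \<open>x / g x\<close> and its value at 0\<close>

lemma tendsto_at_right_INF:
  fixes g :: "real \<Rightarrow> real"
  assumes mono: "mono_on {0<..} g" and bdd: "bdd_below (g ` {0<..})"
  shows "(g \<longlongrightarrow> (INF x\<in>{0<..}. g x)) (at_right 0)"
proof (rule decreasing_tendsto)
  show "\<forall>\<^sub>F x in at_right 0. (INF x\<in>{0<..}. g x) \<le> g x"
    using bdd by (auto simp: eventually_at_right_field intro!: cINF_lower exI[of _ 1])
next
  fix y assume "(INF x\<in>{0<..}. g x) < y"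
  then obtain x where "x > 0" "g x < y"
    using bdd by (auto simp: cINF_less_iff)
  then show "\<forall>\<^sub>F x in at_right 0. g x < y"
    using mono by (auto simp: eventually_at_right_field mono_on_def intro!: exI[of _ x])
      (smt (verit))
qed

lemma INF_le_quotient:
  fixes g :: "real \<Rightarrow> real"
  assumes "g \<in> {0..} \<rightarrow> {0..}" and "x > 0"
  shows "(INF x\<in>{0<..}. x / g x) \<le> x / g x"
  using assms by (intro cINF_lower bdd_belowI2[of _ 0]) (auto simp: Pi_iff)

lemma tendsto_quotient_at_right_0:
  fixes g :: "real \<Rightarrow> real"
  assumes "g \<in> {0..} \<rightarrow> {0..}" and "mono_on {0<..} (\<lambda>x. x / g x)"
  shows "((\<lambda>x. x / g x) \<longlongrightarrow> (INF x\<in>{0<..}. x / g x)) (at_right 0)"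
  using assms by (intro tendsto_at_right_INF bdd_belowI2[of _ 0]) (auto simp: Pi_iff)

text \<open>A nondecreasing quotient bounded below tends to its infimum as \<open>x\<close>
  decreases to 0, so the limit inferior is finite and \<open>real_of_ereal\<close> loses
  nothing.\<close>

lemma quot_liminf_eq:
  assumes "g \<in> {0..} \<rightarrow> {0..}" and "mono_on {0<..} (\<lambda>x. x / g x)"
  shows "quot_liminf g x = (if x = 0 \<and> g 0 = 0 then INF x\<in>{0<..}. x / g x else x / g x)"
proof -
  have "Liminf (at_right 0) (\<lambda>t. ereal (t / g t)) = ereal (INF x\<in>{0<..}. x / g x)"
    using tendsto_quotient_at_right_0[OF assms] by (intro lim_imp_Liminf) auto
  then show ?thesis
    by (simp add: quot_liminf_def)
qed

lemma quot_lim_eq: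
  assumes "g \<in> {0..} \<rightarrow> {0..}" and "mono_on {0<..} (\<lambda>x. x / g x)"
  shows "quot_lim g x = (if x = 0 \<and> g 0 = 0 then INF x\<in>{0<..}. x / g x else x / g x)"
  using tendsto_Lim[OF _ tendsto_quotient_at_right_0[OF assms]] by (simp add: quot_lim_def)

lemma quotient_at_0_nonneg:
  fixes g :: "real \<Rightarrow> real"
  assumes "g \<in> {0..} \<rightarrow> {0..}" and "x \<ge> 0"
  shows "0 \<le> (if x = 0 \<and> g 0 = 0 then INF x\<in>{0<..}. x / g x else x / g x)"
  using assms by (auto intro!: cINF_greatest simp: Pi_iff)

text \<open>At 0 the value is the infimum if \<open>g 0 = 0\<close> and \<open>0 / g 0 = 0\<close>
  otherwise; neither exceeds a quotient at a positive argument.\<close>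

lemma quotient_at_0_mono:
  fixes g :: "real \<Rightarrow> real"
  assumes nonneg: "g \<in> {0..} \<rightarrow> {0..}" and mono: "mono_on {0<..} (\<lambda>x. x / g x)"
  shows "mono_on {0..} (\<lambda>x. if x = 0 \<and> g 0 = 0 then INF x\<in>{0<..}. x / g x else x / g x)"
proof (rule mono_onI)
  fix r s :: real
  assume rs: "r \<in> {0..}" "s \<in> {0..}" "r \<le> s"
  consider "r = s" | "r = 0" "s > 0" | "r > 0" "s > 0"
    using rs by fastforce
  then show "(if r = 0 \<and> g 0 = 0 then INF x\<in>{0<..}. x / g x else r / g r)
      \<le> (if s = 0 \<and> g 0 = 0 then INF x\<in>{0<..}. x / g x else s / g s)"
  proof cases
    case 2
    then show ?thesis
      using INF_le_quotient[of g s] nonneg by (auto simp: Pi_iff)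
  next
    case 3
    then show ?thesis
      using rs mono_onD[OF mono, of r s] by auto
  qed auto
qed

lemma bernstein_function_quotient_mono:
  assumes "bernstein_function u"
  shows "mono_on {0<..} (\<lambda>x. x / u x)"
proof (rule mono_onI)
  fix r s :: real
  assume "r \<in> {0<..}" "s \<in> {0<..}" "r \<le> s"
  moreover from this have "u s / s \<le> u r / r" "u r > 0" "u s > 0"
    using assms by (auto simp: bernstein_function_def monotone_on_def)
  ultimately show "r / u r \<le> s / u s"
    by (simp add: field_simps)
qed

lemma rate_function_of_bernstein:
  assumes u: "bernstein_function u" and "b > 0" "c > 0"
  shows "rate_function (\<lambda>x. min (c * quot_liminf u x) b)"
proof -
  have pos: "u x > 0" if "x > 0" for x
    using u that by (simp add: bernstein_function_def)
  have nonneg: "u \<in> {0..} \<rightarrow> {0..}"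
    using u by (simp add: bernstein_function_def)
  note mono = bernstein_function_quotient_mono[OF u]
  note eq = quot_liminf_eq[of u, OF nonneg mono]
  have "quot_liminf u x \<ge> 0" if "x \<ge> 0" for x
    unfolding eq by (rule quotient_at_0_nonneg[of u x, OF nonneg that])
  moreover have "mono_on {0..} (quot_liminf u)"
    unfolding eq by (rule quotient_at_0_mono[OF nonneg mono])
  moreover have "quot_liminf u x > 0" if "x > 0" for x
    using that pos by (simp add: eq)
  moreover have "mono_on {0..} (\<lambda>x. min (c * quot_liminf u x) b)"
    using \<open>mono_on {0..} (quot_liminf u)\<close> \<open>c > 0\<close>
    by (intro mono_onI min.mono mult_left_mono) (auto intro: mono_onD)
  ultimately show ?thesis
    using assms(2,3) by (auto simp: rate_function_def intro!: bdd_aboveI2[of _ _ b])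
qed

text \<open>
  Bounding by \<open>max r \<epsilon>\<close> covers at once the actions of excess risk at least \<open>\<epsilon>\<close> (mean at most 1)
  and those of smaller excess risk (mean at most \<open>exp (\<eta> * \<epsilon>)\<close>), including the case \<open>r = \<epsilon> = 0\<close>.
\<close>

lemma bernstein_rate_le:
  assumes u: "bernstein_function u" and "b > 0" "k > 0" and "r \<ge> 0" "\<epsilon> \<ge> 0"
  shows "k * min (1 / k * quot_liminf u \<epsilon>) b * u r \<le> max r \<epsilon>"
proof -
  let ?v = "\<lambda>x. min (1 / k * quot_liminf u x) b"
  define m where "m = max r \<epsilon>"
  have m: "m \<ge> 0" "r \<le> m" "\<epsilon> \<le> m"
    using assms by (auto simp: m_def)
  have pos: "u x > 0" if "x > 0" for x
    using u that by (simp add: bernstein_function_def)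
  have nonneg: "u x \<ge> 0" if "x \<ge> 0" for x
    using u that by (auto simp: bernstein_function_def Pi_iff)
  have rate: "rate_function ?v"
    using assms by (intro rate_function_of_bernstein) auto
  have "u r \<le> u m"
    using u m assms by (auto simp: bernstein_function_def mono_on_def)
  moreover have "?v \<epsilon> \<le> ?v m" and "0 \<le> ?v m"
    using rate m assms by (auto simp: rate_function_def mono_on_def Pi_iff)
  ultimately have "?v \<epsilon> * u r \<le> ?v m * u m"
    using nonneg[of r] assms by (intro mult_mono) auto
  also have "\<dots> \<le> 1 / k * quot_liminf u m * u m"
    using nonneg[of m] m by (intro mult_right_mono) auto
  \<comment> \<open>For \<open>m = 0\<close> both sides vanish: either \<open>u 0 = 0\<close>, or
    the quotient is \<open>0 / u 0 = 0\<close>.\<close>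
  also have "\<dots> = m / k"
    using m pos[of m] by (cases "m = 0") (auto simp: quot_liminf_def)
  finally show ?thesis
    using assms by (simp add: m_def field_simps)
qed

section \<open>Decision problems with losses in a bounded interval\<close>

locale bounded_decision_problem =
  fixes \<l> :: "'f \<Rightarrow> 'z \<Rightarrow> real" and Z :: "'z measure" and \<P> :: "'z measure set"
    and F :: "'f measure" and a :: real
  assumes problem: "decision_problem \<l> Z \<P> F"
    and bound: "\<And>f z. f \<in> space F \<Longrightarrow> z \<in> space Z \<Longrightarrow> \<l> f z \<in> {0..a}"
begin

lemma prob_space: "P \<in> \<P> \<Longrightarrow> prob_space P"
  and sets_eq: "P \<in> \<P> \<Longrightarrow> sets P = sets Z"
  using problem by (auto simp: decision_problem_def space_prob_algebra)

lemma space_eq: "P \<in> \<P> \<Longrightarrow> space P = space Z"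
  using sets_eq by (rule sets_eq_imp_space_eq)

lemma joint_measurable: "(\<lambda>(f, z). \<l> f z) \<in> borel_measurable (F \<Otimes>\<^sub>M Z)"
  using problem by (simp add: decision_problem_def)

lemma loss_measurable:
  assumes "P \<in> \<P>" "f \<in> space F"
  shows "\<l> f \<in> borel_measurable P"
  unfolding measurable_cong_sets[OF sets_eq[OF assms(1)] refl]
  using measurable_compose[OF measurable_Pair1'[OF assms(2)] joint_measurable] by simp

lemma loss_measurable_action: "z \<in> space Z \<Longrightarrow> (\<lambda>f. \<l> f z) \<in> borel_measurable F"
  using measurable_compose[OF measurable_Pair2' joint_measurable] by simp

lemma loss_integrable:
  assumes "P \<in> \<P>" "f \<in> space F"
  shows "integrable P (\<l> f)"
  using assms bound[of f] loss_measurable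
  by (intro prob_space.integrable_bounded[of P _ a] prob_space) (auto simp: space_eq)

lemma abs_loss_diff_le:
  "f \<in> space F \<Longrightarrow> g \<in> space F \<Longrightarrow> z \<in> space Z \<Longrightarrow> \<bar>\<l> f z - \<l> g z\<bar> \<le> a"
  using bound[of f z] bound[of g z] by (auto simp: abs_le_iff)

lemma risk_diff:
  assumes "P \<in> \<P>" "f \<in> space F" "g \<in> space F"
  shows "(LINT z|P. \<l> f z - \<l> g z) = risk \<l> P f - risk \<l> P g"
  using assms by (simp add: risk_def loss_integrable)

text \<open>Nonnegative losses bound the risks below, which makes the real-valued infimum in
  \<open>optimal\<close> a genuine lower bound.\<close>

lemma optimal_risk_le:
  assumes P: "P \<in> \<P>" and "optimal \<l> F P fs" and f: "f \<in> space F"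
  shows "risk \<l> P fs \<le> risk \<l> P f"
proof -
  have "0 \<le> risk \<l> P g" if "g \<in> space F" for g
    unfolding risk_def using bound that P by (intro integral_nonneg_AE) (auto simp: space_eq)
  then have "bdd_below (risk \<l> P ` space F)"
    by (rule bdd_belowI2)
  with assms show ?thesis
    by (auto simp: optimal_def intro: cINF_lower)
qed

section \<open>From the Bernstein condition to the central condition\<close>

text \<open>One estimate serves both claims of the first part: the exponent is at most
  \<open>\<eta> * \<epsilon>\<close> for every action, and it is 0 once the excess risk reaches
  \<open>\<epsilon>\<close>.\<close>

lemma bernstein_at_exp_le:
  assumes u: "bernstein_function u" and P: "P \<in> \<P>" and fs: "bernstein_at u \<l> F P fs"
    and f: "f \<in> space F" and "b > 0" "\<epsilon> \<ge> 0"
    and \<eta>: "\<eta> = min (1 / kappa (2 * b * a) * quot_liminf u \<epsilon>) b"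
  shows "(LINT z|P. exp (\<eta> * (\<l> fs z - \<l> f z)))
    \<le> exp (\<eta> * (max (risk \<l> P f - risk \<l> P fs) \<epsilon> - (risk \<l> P f - risk \<l> P fs)))"
proof -
  let ?k = "kappa (2 * b * a)" and ?X = "\<lambda>z. \<l> f z - \<l> fs z"
  define r where "r = risk \<l> P f - risk \<l> P fs"
  have fs': "optimal \<l> F P fs" "fs \<in> space F"
    using fs by (auto simp: bernstein_at_def optimal_def)
  interpret prob_space P
    using P by (rule prob_space)
  have r: "expectation ?X = r" "r \<ge> 0"
    using risk_diff[OF P f fs'(2)] optimal_risk_le[OF P fs'(1) f] by (auto simp: r_def)
  have rate: "rate_function (\<lambda>x. min (1 / ?k * quot_liminf u x) b)"
    using assms kappa_pos by (intro rate_function_of_bernstein) auto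
  then have \<eta>_bounds: "0 \<le> \<eta>" "\<eta> \<le> b"
    using assms by (auto simp: rate_function_def Pi_iff)
  have var: "variance ?X \<le> u r"
    unfolding r(1)[symmetric] using fs f unfolding bernstein_at_def by blast
  have "(LINT z|P. exp (\<eta> * (\<l> fs z - \<l> f z))) = (LINT z|P. exp (- \<eta> * ?X z))"
    by (simp add: algebra_simps)
  also have "\<dots> \<le> exp (- \<eta> * r + ?k * \<eta>\<^sup>2 * variance ?X)"
    unfolding r(1)[symmetric] using P f fs' loss_measurable abs_loss_diff_le \<eta>_bounds
    by (intro mgf_le_exp_variance) (auto simp: space_eq)
  also have "?k * \<eta>\<^sup>2 * variance ?X \<le> ?k * \<eta>\<^sup>2 * u r"
    using var kappa_pos[of "2 * b * a"] by (intro mult_left_mono) auto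
  also have "?k * \<eta>\<^sup>2 * u r = \<eta> * (?k * \<eta> * u r)"
    by (simp add: power2_eq_square)
  also have "\<dots> \<le> \<eta> * max r \<epsilon>"
    unfolding \<eta> using assms r kappa_pos \<eta>_bounds
    by (intro mult_left_mono bernstein_rate_le) auto
  finally show ?thesis
    by (simp add: r_def algebra_simps)
qed

text \<open>Optimal actions have equal risk, so the loss difference has mean 0 and, since
  \<open>u 0 = 0\<close>, variance 0. The losses then agree almost surely, and mean and variance of
  every excess loss carry over.\<close>

lemma bernstein_at_optimal:
  assumes P: "P \<in> \<P>" and f0: "bernstein_at u \<l> F P f0" and fs: "optimal \<l> F P fs"
    and "u 0 = 0"
  shows "bernstein_at u \<l> F P fs"
proof -
  have f0': "optimal \<l> F P f0" and sp: "fs \<in> space F" "f0 \<in> space F"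
    using f0 fs by (auto simp: bernstein_at_def optimal_def)
  interpret prob_space P
    using P by (rule prob_space)
  have "risk \<l> P fs = risk \<l> P f0"
    using f0' fs by (simp add: optimal_def)
  then have mean: "expectation (\<lambda>z. \<l> fs z - \<l> f0 z) = 0"
    using risk_diff[OF P sp] by simp
  have "variance (\<lambda>z. \<l> fs z - \<l> f0 z) \<le> u (expectation (\<lambda>z. \<l> fs z - \<l> f0 z))"
    using f0 sp unfolding bernstein_at_def by blast
  then have "variance (\<lambda>z. \<l> fs z - \<l> f0 z) \<le> 0"
    by (simp only: mean \<open>u 0 = 0\<close>)
  then have "expectation (\<lambda>z. (\<l> fs z - \<l> f0 z)\<^sup>2) = 0"
    unfolding mean by (intro antisym) auto
  moreover have "integrable P (\<lambda>z. (\<l> fs z - \<l> f0 z)\<^sup>2)"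
    using loss_measurable[OF P] sp power_mono[OF abs_loss_diff_le[OF sp], of _ 2]
    by (intro integrable_bounded[of _ "a\<^sup>2"]) (auto simp: space_eq[OF P])
  ultimately have "AE z in P. \<l> fs z = \<l> f0 z"
    by (subst (asm) integral_nonneg_eq_0_iff_AE) auto
  then have same: "(LINT z|P. h (\<l> f z - \<l> fs z)) = (LINT z|P. h (\<l> f z - \<l> f0 z))"
    if "f \<in> space F" "h \<in> borel_measurable borel" for f and h :: "real \<Rightarrow> real"
    using loss_measurable[OF P] sp that
    by (intro integral_cong_AE) auto
  have "variance (\<lambda>z. \<l> f z - \<l> fs z) \<le> u (expectation (\<lambda>z. \<l> f z - \<l> fs z))"
    if f: "f \<in> space F" for f
    using f0 f same[OF f, of "\<lambda>x. x"] same[OF f, of "\<lambda>x. (x - expectation (\<lambda>z. \<l> f z - \<l> f0 z))\<^sup>2"]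
    by (simp add: bernstein_at_def)
  with fs show ?thesis
    by (simp add: bernstein_at_def)
qed

text \<open>The same choice \<open>\<phi>\<close> of Bernstein witnesses works for every
  \<open>\<epsilon>\<close>. Fubini's theorem moves the average over actions outside, where
  \<open>bernstein_at_exp_le\<close> bounds each inner expectation.\<close>

lemma central_of_bernstein:
  assumes cond: "bernstein_condition u \<l> \<P> F" and "b > 0"
  shows "central_condition (\<lambda>x. min (1 / kappa (2 * b * a) * quot_liminf u x) b) \<l> \<P> F"
    (is "central_condition ?v _ _ _")
proof -
  from cond have u: "bernstein_function u"
    by (simp add: bernstein_condition_def)
  from cond obtain \<phi> where \<phi>: "\<And>P. P \<in> \<P> \<Longrightarrow> bernstein_at u \<l> F P (\<phi> P)"
    unfolding bernstein_condition_def by metis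
  have \<phi>F: "\<phi> P \<in> space F" if "P \<in> \<P>" for P
    using \<phi>[OF that] by (simp add: bernstein_at_def optimal_def)
  have rate: "rate_function ?v"
    using u \<open>b > 0\<close> kappa_pos by (intro rate_function_of_bernstein) auto
  have "(LINT z|P. LINT f|Q. exp (?v \<epsilon> * (\<l> (\<phi> P) z - \<l> f z))) \<le> exp (?v \<epsilon> * \<epsilon>)"
    if \<epsilon>: "\<epsilon> \<ge> 0" and P: "P \<in> \<P>" and Q: "Q \<in> space (prob_algebra F)" for \<epsilon> P Q
  proof -
    define \<eta> where "\<eta> = ?v \<epsilon>"
    have \<eta>: "\<eta> \<ge> 0"
      using rate \<epsilon> by (auto simp: rate_function_def Pi_iff \<eta>_def)
    have setsQ: "sets Q = sets F"
      using Q by (simp add: space_prob_algebra)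
    have spaceQ: "space Q = space F"
      using setsQ by (rule sets_eq_imp_space_eq)
    interpret P: prob_space P
      using P by (rule prob_space)
    interpret Q: prob_space Q
      using Q by (simp add: space_prob_algebra)
    interpret QP: pair_prob_space Q P ..
    let ?h = "\<lambda>f z. exp (\<eta> * (\<l> (\<phi> P) z - \<l> f z))"
    have [measurable]: "(\<lambda>(f, z). \<l> f z) \<in> borel_measurable (Q \<Otimes>\<^sub>M P)"
      using joint_measurable
      unfolding measurable_cong_sets[OF sets_pair_measure_cong[OF setsQ sets_eq[OF P]] refl] .
    have [measurable]: "\<l> (\<phi> P) \<in> borel_measurable P"
      using loss_measurable P \<phi>F by simp
    have "case_prod ?h \<in> borel_measurable (Q \<Otimes>\<^sub>M P)"
      by (simp add: case_prod_unfold) measurable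
    moreover have "?h f z \<le> exp (\<eta> * a)" if "f \<in> space F" "z \<in> space Z" for f z
      using abs_loss_diff_le[OF \<phi>F[OF P] that] \<eta> by (auto intro!: mult_left_mono)
    ultimately have int: "integrable (Q \<Otimes>\<^sub>M P) (case_prod ?h)"
      using P spaceQ
      by (intro QP.P.integrable_bounded[of _ "exp (\<eta> * a)"]) (auto simp: space_pair_measure space_eq)
    have "(LINT z|P. LINT f|Q. ?h f z) = (LINT f|Q. LINT z|P. ?h f z)"
      by (rule QP.Fubini_integral[OF int])
    also have "\<dots> \<le> (LINT f|Q. exp (\<eta> * \<epsilon>))"
    proof (rule integral_mono)
      show "integrable Q (\<lambda>f. LINT z|P. ?h f z)"
        using QP.integrable_fst[OF int] by simp
    next
      fix f assume "f \<in> space Q"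
      then have f: "f \<in> space F"
        by (simp add: spaceQ)
      have "optimal \<l> F P (\<phi> P)"
        using \<phi>[OF P] by (simp add: bernstein_at_def)
      from optimal_risk_le[OF P this f]
      have "max (risk \<l> P f - risk \<l> P (\<phi> P)) \<epsilon> - (risk \<l> P f - risk \<l> P (\<phi> P)) \<le> \<epsilon>"
        using \<epsilon> by auto
      then have "\<eta> * (max (risk \<l> P f - risk \<l> P (\<phi> P)) \<epsilon> - (risk \<l> P f - risk \<l> P (\<phi> P))) \<le> \<eta> * \<epsilon>"
        using \<eta> by (rule mult_left_mono)
      with bernstein_at_exp_le[OF u P \<phi>[OF P] f \<open>b > 0\<close> \<epsilon> \<eta>_def]
      show "(LINT z|P. ?h f z) \<le> exp (\<eta> * \<epsilon>)"
        by (meson exp_le_cancel_iff order_trans)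
    qed simp
    finally show ?thesis
      by (simp add: \<eta>_def Q.prob_space)
  qed
  with rate \<phi>F show ?thesis
    unfolding central_condition_def by (auto intro!: bexI[of _ \<phi>])
qed

section \<open>From pseudoprobability convexity to the Bernstein condition\<close>

text \<open>The parameter \<open>\<epsilon>\<close> stays free because it is later either set to the
  excess risk or left to range over all positive numbers.\<close>

lemma ppc_second_moment_le:
  assumes ppc: "ppc_condition v \<l> \<P> F" and P: "P \<in> \<P>" and fs: "optimal \<l> F P fs"
    and f: "f \<in> space F" and \<epsilon>: "\<epsilon> \<ge> 0" "v \<epsilon> > 0" "v \<epsilon> \<le> b"
  shows "(LINT z|P. (\<l> f z - \<l> fs z)\<^sup>2)
    \<le> 4 / kappa (- 2 * b * a) * ((\<epsilon> + (risk \<l> P f - risk \<l> P fs) / 2) / v \<epsilon>)"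
proof -
  define \<eta> where "\<eta> = v \<epsilon>"
  have \<eta>: "0 < \<eta>" "\<eta> \<le> b"
    using \<epsilon> by (auto simp: \<eta>_def)
  have fsF: "fs \<in> space F"
    using fs by (simp add: optimal_def)
  interpret prob_space P
    using P by (rule prob_space)
  \<comment> \<open>Mixing \<open>f\<close> and \<open>fs\<close> with equal weights makes PPC a bound on the mean of
    \<open>ln ((1 + exp (- \<eta> * X)) / 2)\<close> for the excess loss \<open>X\<close>, as \<open>fs\<close> is no riskier than \<open>\<phi> P\<close>.\<close>
  let ?Q = "distr (measure_pmf (bernoulli_pmf (1 / 2))) F (\<lambda>c. if c then f else fs)"
  let ?L = "\<lambda>z. ln ((1 + exp (- \<eta> * (\<l> f z - \<l> fs z))) / 2)"
  have Q: "?Q \<in> space (prob_algebra F)"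
    using f fsF by (auto simp: space_prob_algebra intro!: measure_pmf.prob_space_distr)
  from ppc \<epsilon> obtain \<phi> where \<phi>: "\<phi> \<in> \<P> \<rightarrow> space F"
    and le: "\<And>P Q. P \<in> \<P> \<Longrightarrow> Q \<in> space (prob_algebra F) \<Longrightarrow>
      (LINT z|P. \<l> (\<phi> P) z) \<le> (LINT z|P. mix_loss \<eta> \<l> Q z) + \<epsilon>"
    unfolding ppc_condition_def \<eta>_def by meson
  have mix: "mix_loss \<eta> \<l> ?Q z = \<l> fs z - ?L z / \<eta>" if z: "z \<in> space Z" for z
  proof -
    have "(LINT g|?Q. exp (- \<eta> * \<l> g z))
        = (LINT c|measure_pmf (bernoulli_pmf (1 / 2)). exp (- \<eta> * \<l> (if c then f else fs) z))"
      using f fsF loss_measurable_action[OF z] by (intro integral_distr) auto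
    also have "\<dots> = (exp (- \<eta> * \<l> f z) + exp (- \<eta> * \<l> fs z)) / 2"
      by (simp add: field_simps)
    also have "\<dots> = exp (- \<eta> * \<l> fs z) * ((1 + exp (- \<eta> * (\<l> f z - \<l> fs z))) / 2)"
      by (simp add: algebra_simps add_divide_distrib flip: exp_add)
    also have "ln \<dots> = - \<eta> * \<l> fs z + ?L z"
      by (subst ln_mult_pos) (auto simp: add_pos_pos)
    finally show ?thesis
      using \<eta> by (simp add: mix_loss_def field_simps)
  qed
  have "\<bar>?L z\<bar> \<le> \<eta> * a" if z: "z \<in> space Z" for z
  proof -
    have "\<bar>\<eta> * (\<l> f z - \<l> fs z)\<bar> \<le> \<eta> * a"
      using abs_loss_diff_le[OF f fsF z] \<eta> by (simp add: abs_mult)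
    from abs_log_mean_exp_minus_le[OF this] show ?thesis
      by simp
  qed
  then have intL: "integrable P ?L"
    using P f fsF loss_measurable by (intro integrable_bounded) (auto simp: space_eq)
  have "risk \<l> P fs \<le> risk \<l> P (\<phi> P)"
    using optimal_risk_le[OF P fs] \<phi> P by auto
  also have "\<dots> \<le> (LINT z|P. mix_loss \<eta> \<l> ?Q z) + \<epsilon>"
    using le[OF P Q] by (simp add: risk_def)
  also have "(LINT z|P. mix_loss \<eta> \<l> ?Q z) = (LINT z|P. \<l> fs z - ?L z / \<eta>)"
    using mix P by (intro Bochner_Integration.integral_cong) (auto simp: space_eq)
  also have "\<dots> = risk \<l> P fs - (LINT z|P. ?L z) / \<eta>"
    using intL loss_integrable[OF P fsF] by (simp add: risk_def)
  finally have "(LINT z|P. ?L z) \<le> \<eta> * \<epsilon>"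
    using \<eta> by (simp add: field_simps)
  then have "expectation (\<lambda>z. (\<l> f z - \<l> fs z)\<^sup>2)
      \<le> 4 / kappa (- 2 * b * a) * ((\<epsilon> + expectation (\<lambda>z. \<l> f z - \<l> fs z) / 2) / \<eta>)"
    using P f fsF loss_measurable abs_loss_diff_le \<eta>
    by (intro second_moment_le_of_log_mean_exp) (auto simp: space_eq)
  then show ?thesis
    by (simp add: risk_diff[OF P f fsF] \<eta>_def)
qed

lemma bernstein_of_ppc:
  assumes opt: "\<And>P. P \<in> \<P> \<Longrightarrow> \<exists>fs. optimal \<l> F P fs"
    and rate: "rate_function v" and mono: "mono_on {0<..} (\<lambda>x. x / v x)"
    and ppc: "ppc_condition v \<l> \<P> F"
    and le_b: "\<And>x. x \<ge> 0 \<Longrightarrow> v x \<le> b"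
  shows "bernstein_condition (\<lambda>x. 6 / kappa (- 2 * b * a) * quot_lim v x) \<l> \<P> F"
proof -
  let ?k = "kappa (- 2 * b * a)"
  have k: "?k > 0"
    by (rule kappa_pos)
  have pos: "v x > 0" if "x > 0" for x
    using rate that by (simp add: rate_function_def)
  have nonneg: "v \<in> {0..} \<rightarrow> {0..}"
    using rate by (simp add: rate_function_def)
  note eq = quot_lim_eq[of v, OF nonneg mono]
  have quot_nonneg: "quot_lim v x \<ge> 0" if "x \<ge> 0" for x
    unfolding eq by (rule quotient_at_0_nonneg[of v x, OF nonneg that])
  have quot_mono: "mono_on {0..} (quot_lim v)"
    unfolding eq by (rule quotient_at_0_mono[OF nonneg mono])
  have "bernstein_function (\<lambda>x. 6 / ?k * quot_lim v x)"
    unfolding bernstein_function_def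
  proof (intro conjI allI impI)
    show "(\<lambda>x. 6 / ?k * quot_lim v x) \<in> {0..} \<rightarrow> {0..}"
      using quot_nonneg k by auto
    show "mono_on {0..} (\<lambda>x. 6 / ?k * quot_lim v x)"
      using quot_mono k by (auto simp: mono_on_def divide_right_mono)
    show "6 / ?k * quot_lim v x > 0" if "x > 0" for x
      using that pos k by (simp add: eq)
    \<comment> \<open>For positive arguments the ratio is a constant divided by \<open>v x\<close>,
      and \<open>v\<close> is nondecreasing.\<close>
    show "antimono_on {0<..} (\<lambda>x. 6 / ?k * quot_lim v x / x)"
    proof (rule monotone_onI)
      fix x y :: real
      assume xy: "x \<in> {0<..}" "y \<in> {0<..}" "x \<le> y"
      then have "v x \<le> v y"
        using rate by (auto simp: rate_function_def mono_on_def)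
      then have "6 / ?k / v y \<le> 6 / ?k / v x"
        using xy pos k by (intro divide_left_mono) auto
      then show "6 / ?k * quot_lim v y / y \<le> 6 / ?k * quot_lim v x / x"
        using xy by (simp add: eq)
    qed
  qed
  moreover have "bernstein_at (\<lambda>x. 6 / ?k * quot_lim v x) \<l> F P fs"
    if P: "P \<in> \<P>" and fs: "optimal \<l> F P fs" for P fs
    unfolding bernstein_at_def
  proof (intro conjI ballI fs)
    fix f assume f: "f \<in> space F"
    have fsF: "fs \<in> space F"
      using fs by (simp add: optimal_def)
    interpret prob_space P
      using P by (rule prob_space)
    define r where "r = risk \<l> P f - risk \<l> P fs"
    define M2 where "M2 = expectation (\<lambda>z. (\<l> f z - \<l> fs z)\<^sup>2)"
    have r: "expectation (\<lambda>z. \<l> f z - \<l> fs z) = r" "r \<ge> 0"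
      using risk_diff[OF P f fsF] optimal_risk_le[OF P fs f] by (auto simp: r_def)
    have int2: "integrable P (\<lambda>z. (\<l> f z - \<l> fs z)\<^sup>2)"
      using loss_measurable[OF P] f fsF power_mono[OF abs_loss_diff_le[OF f fsF], of _ 2]
      by (intro integrable_bounded[of _ "a\<^sup>2"]) (auto simp: space_eq[OF P])
    have var: "variance (\<lambda>z. \<l> f z - \<l> fs z) \<le> M2"
      using int2 loss_integrable[OF P] f fsF by (subst variance_eq) (auto simp: M2_def)
    have M2: "M2 \<le> 4 / ?k * ((\<epsilon> + r / 2) / v \<epsilon>)" if "\<epsilon> \<ge> 0" "v \<epsilon> > 0" for \<epsilon>
      using ppc_second_moment_le[OF ppc P fs f that le_b[OF that(1)]] by (simp add: M2_def r_def)
    have "M2 \<le> 6 / ?k * quot_lim v r"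
    proof (cases "r = 0 \<and> v 0 = 0")
      case True
      \<comment> \<open>PPC is vacuous at \<open>\<epsilon> = 0\<close> here, so every
        \<open>x > 0\<close> serves as \<open>\<epsilon>\<close>. With \<open>r = 0\<close> the
        constant is 4; nonnegativity of the infimum allows enlarging it to 6.\<close>
      have "?k / 4 * M2 \<le> (INF x\<in>{0<..}. x / v x)"
      proof (rule cINF_greatest)
        fix x :: real assume "x \<in> {0<..}"
        then show "?k / 4 * M2 \<le> x / v x"
          using M2[of x] pos[of x] True k by (simp add: field_simps)
      qed auto
      moreover have "0 \<le> (INF x\<in>{0<..}. x / v x)"
        using quot_nonneg[of 0] True by (simp add: eq)
      ultimately show ?thesis
        using True k by (simp add: eq field_simps)
    next
      case False
      then have "v r > 0"
        using r pos[of r] nonneg by (cases "r = 0") (auto simp: Pi_iff less_le)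
      \<comment> \<open>With \<open>\<epsilon> = r\<close> the numerator is
        \<open>r + r / 2\<close>, and 4 times 3/2 gives the constant 6.\<close>
      with M2[of r] r False k show ?thesis
        by (auto simp: eq field_simps)
    qed
    with var show "variance (\<lambda>z. \<l> f z - \<l> fs z)
        \<le> 6 / ?k * quot_lim v (expectation (\<lambda>z. \<l> f z - \<l> fs z))"
      by (simp add: r)
  qed
  ultimately show ?thesis
    using opt unfolding bernstein_condition_def by metis
qed

end

theorem theorem5p4:
  fixes \<l> :: "'f \<Rightarrow> 'z \<Rightarrow> real" and Z :: "'z measure" and \<P> :: "'z measure set"
    and F :: "'f measure" and a :: real
  assumes "decision_problem \<l> Z \<P> F"
    and "\<forall>f\<in>space F. \<forall>z\<in>space Z. \<l> f z \<in> {0..a}"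
  shows
    "(\<forall>u b c1 v. bernstein_condition u \<l> \<P> F \<longrightarrow> b > 0 \<longrightarrow>
        c1 = 1 / kappa (2 * b * a) \<longrightarrow>
        v = (\<lambda>x. min (c1 * quot_liminf u x) b) \<longrightarrow>
        central_condition v \<l> \<P> F \<and>
        (\<forall>P\<in>\<P>. \<forall>fs. \<forall>\<delta>>0.
           optimal \<l> F P fs \<and> (u 0 = 0 \<or> bernstein_at u \<l> F P fs) \<longrightarrow>
           (\<forall>f\<in>space F. risk \<l> P f - risk \<l> P fs \<ge> \<delta> \<longrightarrow>
              (LINT z|P. exp (v \<delta> * (\<l> fs z - \<l> f z))) \<le> 1)))
     \<and>
     (\<forall>v b c2. (\<forall>P\<in>\<P>. \<exists>fs. optimal \<l> F P fs) \<longrightarrow>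
        rate_function v \<longrightarrow> mono_on {0<..} (\<lambda>x. x / v x) \<longrightarrow>
        ppc_condition v \<l> \<P> F \<longrightarrow>
        b = (SUP x\<in>{0..}. v x) \<longrightarrow>
        c2 = 6 / kappa (- 2 * b * a) \<longrightarrow>
        bernstein_condition (\<lambda>x. c2 * quot_lim v x) \<l> \<P> F)"
proof -
  interpret bounded_decision_problem \<l> Z \<P> F a
    using assms by unfold_locales auto
  show ?thesis
  proof (intro conjI allI impI ballI)
    fix u v :: "real \<Rightarrow> real" and b c1 :: real
    assume cond: "bernstein_condition u \<l> \<P> F" and b: "b > 0"
      and "c1 = 1 / kappa (2 * b * a)" and "v = (\<lambda>x. min (c1 * quot_liminf u x) b)"
    then have v: "v = (\<lambda>x. min (1 / kappa (2 * b * a) * quot_liminf u x) b)"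
      by simp
    show "central_condition v \<l> \<P> F"
      unfolding v using cond b by (rule central_of_bernstein)
    fix P fs f and \<delta> :: real
    assume P: "P \<in> \<P>" and \<delta>: "\<delta> > 0" and f: "f \<in> space F"
      and fs: "optimal \<l> F P fs \<and> (u 0 = 0 \<or> bernstein_at u \<l> F P fs)"
      and gap: "risk \<l> P f - risk \<l> P fs \<ge> \<delta>"
    \<comment> \<open>If \<open>u 0 = 0\<close>, the property passes from the witness in the
      Bernstein condition to \<open>fs\<close>; otherwise it is assumed.\<close>
    have "bernstein_at u \<l> F P fs"
      using cond fs P bernstein_at_optimal unfolding bernstein_condition_def by blast
    then have "(LINT z|P. exp (v \<delta> * (\<l> fs z - \<l> f z)))
        \<le> exp (v \<delta> * (max (risk \<l> P f - risk \<l> P fs) \<delta> - (risk \<l> P f - risk \<l> P fs)))"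
      using cond P f b \<delta> by (intro bernstein_at_exp_le) (auto simp: bernstein_condition_def v)
    \<comment> \<open>The gap makes the maximum equal to the excess risk, so the exponent is
      0.\<close>
    with gap show "(LINT z|P. exp (v \<delta> * (\<l> fs z - \<l> f z))) \<le> 1"
      by (simp add: max_def split: if_splits)
  next
    fix v :: "real \<Rightarrow> real" and b c2 :: real
    assume opt: "\<forall>P\<in>\<P>. \<exists>fs. optimal \<l> F P fs" and rate: "rate_function v"
      and mono: "mono_on {0<..} (\<lambda>x. x / v x)" and ppc: "ppc_condition v \<l> \<P> F"
      and b: "b = (SUP x\<in>{0..}. v x)" and c2: "c2 = 6 / kappa (- 2 * b * a)"
    have "v x \<le> b" if "x \<ge> 0" for x
      unfolding b using rate that by (intro cSUP_upper) (auto simp: rate_function_def)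
    then show "bernstein_condition (\<lambda>x. c2 * quot_lim v x) \<l> \<P> F"
      unfolding c2 using opt rate mono ppc by (intro bernstein_of_ppc) auto
  qed
qed

end
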